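(* Let $G$ be a finite simple graph without isolated vertices on the vertex set $[n]$, and let $\mathbf{k}=(k_1,\ldots,k_n)\in\mathbb{N}^n$ satisfy $1\le k_i\le \deg_G(i)+1$ for all $i$. Define $\mathbf{m}=(m_1,\ldots,m_n)$ by $m_i=\deg_G(i)-k_i+2$ for each $i\in[n]$. Then a monomial prime ideal $P=(x_{j_1},\ldots,x_{j_\ell})$ of $S=K[x_1,\ldots,x_n]$ is a minimal prime ideal of $\mathrm{NI}_{\mathbf{k}}(G)$ if and only if the set $\{j_1,\ldots,j_\ell\}$ is a minimal $\mathbf{m}$-multiple dominating set of $G$.
   Context: $K$ is a field and $S=K[x_1,\ldots,x_n]$. For a vertex $i$ of $G$, $N_G[i]$ is the closed neighborhood of $i$ ($i$ together with all its neighbors), and for $W\subseteq[n]$ put $\mathbf{x}_W=\prod_{j\in W}x_j$. The $\mathbf{k}$-neighborhood ideal of $G$ is the squarefree monomial ideal of $S$ $$\mathrm{NI}_{\mathbf{k}}(G)=\sum_{i=1}^n\big(\mathbf{x}_W:\ W\subseteq N_G[i],\ |W|=k_i\big).$$ For $\mathbf{m}=(m_1,\ldots,m_n)\in\mathbb{N}^n$ with $1\le m_i\le\deg_G(i)+1$ for all $i$, a subset $D\subseteq[n]$ is called an $\mathbf{m}$-multiple dominating set of $G$ if $|N_G[i]\cap D|\ge m_i$ for all $i\in[n]$; minimality is with respect to inclusion. *)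

theory Defs
  imports
    "HOL-Algebra.Ideal_Product"
    "HOL-Library.Poly_Mapping"
    "Graph_Theory.Pair_Digraph"
begin

text \<open>
  Polynomials in variables indexed by the natural numbers with coefficients in the field
  \<^typ>\<open>'k\<close>: a monomial is its finitely supported exponent vector.  The ring
  $K[x_1,\ldots,x_n]$ is the \<^typ>\<open>'a ring\<close> whose carrier consists of the polynomials in
  which only variables with index in $\{1,\ldots,n\}$ occur.
\<close>

type_synonym 'k mpoly = "(nat \<Rightarrow>\<^sub>0 nat) \<Rightarrow>\<^sub>0 'k"

definition mpoly_ring :: "nat \<Rightarrow> 'k::field mpoly ring"
  where "mpoly_ring n =
    \<lparr> carrier = {p. \<forall>t \<in> Poly_Mapping.keys p. Poly_Mapping.keys t \<subseteq> {1..n}},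
      monoid.mult = (*), one = 1, ring.zero = 0, add = (+) \<rparr>"

definition mvar :: "nat \<Rightarrow> 'k::field mpoly"
  where "mvar j = Poly_Mapping.single (Poly_Mapping.single j 1) 1"

lemma mvar_closed: "j \<in> {1..n} \<Longrightarrow> mvar j \<in> carrier (mpoly_ring n)"
  by (simp add: mpoly_ring_def mvar_def)

lemma mpoly_ring_simps:
  fixes p q :: "'k::field mpoly"
  shows "p \<in> carrier (mpoly_ring n) \<longleftrightarrow>
      (\<forall>t \<in> Poly_Mapping.keys p. Poly_Mapping.keys t \<subseteq> {1..n})"
    and "p \<otimes>\<^bsub>mpoly_ring n\<^esub> q = p * q"
    and "p \<oplus>\<^bsub>mpoly_ring n\<^esub> q = p + q"
    and "\<one>\<^bsub>mpoly_ring n\<^esub> = (1 :: 'k mpoly)"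
    and "\<zero>\<^bsub>mpoly_ring n\<^esub> = (0 :: 'k mpoly)"
  by (simp_all add: mpoly_ring_def)

lemma mpoly_ring_cring: "cring (mpoly_ring n :: 'k::field mpoly ring)"
proof -
  let ?R = "mpoly_ring n :: 'k mpoly ring"
  note ops = mpoly_ring_simps(2-5)
  note C = mpoly_ring_simps(1)
  have add: "p + q \<in> carrier ?R" if "p \<in> carrier ?R" "q \<in> carrier ?R" for p q
    using that Poly_Mapping.keys_add[of p q] unfolding C by (meson Un_iff subsetD)
  have neg: "- p \<in> carrier ?R" if "p \<in> carrier ?R" for p
    using that unfolding C by (simp add: in_keys_iff)
  have mult: "p * q \<in> carrier ?R" if p: "p \<in> carrier ?R" and q: "q \<in> carrier ?R" for p q
    unfolding C
  proof
    fix t assume "t \<in> Poly_Mapping.keys (p * q)"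
    then obtain a b where t: "t = a + b" and a: "a \<in> Poly_Mapping.keys p"
      and b: "b \<in> Poly_Mapping.keys q"
      using keys_mult[of p q] by auto
    have "Poly_Mapping.keys a \<subseteq> {1..n}" "Poly_Mapping.keys b \<subseteq> {1..n}"
      using p q a b unfolding C by simp_all
    then show "Poly_Mapping.keys t \<subseteq> {1..n}"
      using Poly_Mapping.keys_add[of a b] unfolding t by (meson le_sup_iff order_trans)
  qed
  have zero: "0 \<in> carrier ?R" and one: "1 \<in> carrier ?R"
    unfolding C by simp_all
  have "abelian_group ?R"
  proof (rule abelian_groupI)
    fix p assume "p \<in> carrier ?R"
    then have "- p \<in> carrier ?R" by (rule neg)
    then show "\<exists>q\<in>carrier ?R. q \<oplus>\<^bsub>?R\<^esub> p = \<zero>\<^bsub>?R\<^esub>"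
      unfolding ops by (rule bexI[rotated]) simp
  qed (simp_all only: ops add zero add_ac add_0_left add_0_right)
  moreover have "comm_monoid ?R"
    by (rule comm_monoidI) (simp_all only: ops mult one mult_ac mult_1_left mult_1_right)
  ultimately show ?thesis
    by (rule cringI) (simp only: ops distrib_right)
qed

definition minimal_prime_over :: "('a, 'b) ring_scheme \<Rightarrow> 'a set \<Rightarrow> 'a set \<Rightarrow> bool"
  where "minimal_prime_over R I P \<longleftrightarrow>
    primeideal P R \<and> I \<subseteq> P \<and> \<not> (\<exists>Q. primeideal Q R \<and> I \<subseteq> Q \<and> Q \<subset> P)"

text \<open>
  A finite simple graph is a \<^const>\<open>pair_graph\<close>: an edge $\{i,j\}$ is the pair of arcs
  $(i,j)$, $(j,i)$, so the degree of $i$ is its \<^const>\<open>out_degree\<close>.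
\<close>

definition closed_nbhd :: "'a pair_pre_digraph \<Rightarrow> 'a \<Rightarrow> 'a set"
  where "closed_nbhd G i = insert i {j. (i, j) \<in> parcs G}"

text \<open>
  The finite sum of ideals is the sum in the library's semiring of ideals, whose addition is
  $I + J$.
\<close>

definition nbhd_ideal :: "nat \<Rightarrow> (nat \<Rightarrow> nat) \<Rightarrow> nat pair_pre_digraph \<Rightarrow> 'k::field mpoly set"
  where "nbhd_ideal n k G =
    (\<Oplus>\<^bsub>ideals_set (mpoly_ring n)\<^esub> i \<in> {1..n}.
       Idl\<^bsub>mpoly_ring n\<^esub> {\<Prod>j\<in>W. mvar j | W. W \<subseteq> closed_nbhd G i \<and> card W = k i})"

definition multiple_dominating :: "'a pair_pre_digraph \<Rightarrow> ('a \<Rightarrow> nat) \<Rightarrow> 'a set \<Rightarrow> bool"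
  where "multiple_dominating G m D \<longleftrightarrow>
    D \<subseteq> pverts G \<and> (\<forall>i \<in> pverts G. m i \<le> card (closed_nbhd G i \<inter> D))"

definition minimal_multiple_dominating :: "'a pair_pre_digraph \<Rightarrow> ('a \<Rightarrow> nat) \<Rightarrow> 'a set \<Rightarrow> bool"
  where "minimal_multiple_dominating G m D \<longleftrightarrow>
    multiple_dominating G m D \<and> \<not> (\<exists>D'. multiple_dominating G m D' \<and> D' \<subset> D)"

end

theory Submission
  imports Defs
begin

text \<open>
  For a prime ideal \<open>Q\<close> of \<open>S\<close>, the only thing that decides whether \<open>Q\<close> contains a given squarefree
  monomial is the set \<open>V(Q) = {j. x\<^sub>j \<in> Q}\<close>: such a monomial is in \<open>Q\<close> iff one of its variables is.
  Hence \<open>NI\<^sub>k(G) \<subseteq> Q\<close> says that \<open>V(Q)\<close> meets every \<open>k\<^sub>i\<close>-subset of every closed neighbourhood \<open>N[i]\<close>,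
  in other words that fewer than \<open>k\<^sub>i\<close> elements of \<open>N[i]\<close> lie outside \<open>V(Q)\<close>.  As \<open>N[i]\<close> has
  \<open>deg(i) + 1\<close> elements, this means that at least \<open>deg(i) + 2 - k\<^sub>i = m\<^sub>i\<close> elements lie inside, so
  \<open>NI\<^sub>k(G) \<subseteq> Q\<close> iff \<open>V(Q)\<close> is an \<open>m\<close>-multiple dominating set (lemma
  \<open>nbhd_ideal_subset_prime_iff\<close>).

  On the other side, the ideal \<open>P\<^sub>J\<close> generated by the variables with index in \<open>J\<close> is prime with
  \<open>V(P\<^sub>J) = J\<close>, and every ideal \<open>Q\<close> contains \<open>P\<^bsub>V(Q)\<^esub>\<close>.  So \<open>J \<mapsto> P\<^sub>J\<close> and \<open>V\<close> transport minimality in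
  both directions: a smaller dominating set gives a smaller prime, and a prime strictly below \<open>P\<^sub>J\<close>
  that contains the neighbourhood ideal has \<open>V(Q) \<subset> J\<close>.  The algebraic content is the primality of
  \<open>P\<^sub>J\<close>, which rests on the description of \<open>P\<^sub>J\<close> by monomials (\<open>Idl_mvar_eq\<close>).
\<close>

section \<open>Ideals that contain a sum of ideals\<close>

text \<open>
  In the semiring of ideals, \<open>I + J\<close> is the ideal generated by \<open>I \<union> J\<close>, so sums are least upper bounds.
\<close>

lemma (in cring) finsum_ideals_subset_iff:
  assumes "finite A" and "\<And>i. i \<in> A \<Longrightarrow> ideal (F i) R" and Q: "ideal Q R"
  shows "(\<Oplus>\<^bsub>ideals_set R\<^esub> i \<in> A. F i) \<subseteq> Q \<longleftrightarrow> (\<forall>i \<in> A. F i \<subseteq> Q)"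
proof -
  interpret IS: semiring "ideals_set R" by (rule ideals_set_is_semiring)
  have carr: "carrier (ideals_set R) = {I. ideal I R}"
    and add: "\<And>I J. I \<oplus>\<^bsub>ideals_set R\<^esub> J = I <+> J"
    and zero: "\<zero>\<^bsub>ideals_set R\<^esub> = {\<zero>}"
    by (simp_all add: ideals_set_def)
  have sum_subset: "I <+> J \<subseteq> Q \<longleftrightarrow> I \<subseteq> Q \<and> J \<subseteq> Q" if "ideal I R" "ideal J R" for I J
  proof -
    have "I \<union> J \<subseteq> carrier R"
      using that by (auto dest: ideal.Icarr)
    from Idl_subset_ideal[OF Q this] show ?thesis
      using union_genideal[OF that] by simp
  qed
  from assms(1,2) show ?thesis
  proof (induction A rule: finite_induct)
    case empty
    then show ?case
      using Q by (simp add: zero additive_subgroup.zero_closed ideal.axioms(1))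
  next
    case (insert a A)
    have F: "F \<in> A \<rightarrow> carrier (ideals_set R)" and Fa: "F a \<in> carrier (ideals_set R)"
      using insert.prems by (auto simp: carr)
    have "ideal (\<Oplus>\<^bsub>ideals_set R\<^esub> i \<in> A. F i) R"
      using IS.finsum_closed[OF F] by (simp add: carr)
    moreover have "ideal (F a) R" using Fa by (simp add: carr)
    ultimately show ?case
      using insert by (simp add: IS.finsum_insert[OF insert.hyps(1,2) F Fa] add sum_subset)
  qed
qed

section \<open>Ideals generated by variables\<close>

text \<open>
  The right-hand side is an ideal: exponents are natural numbers, so a product of monomials still
  involves every variable of its factors.  Conversely each of its elements is the sum of its terms, and
  a term whose monomial involves a variable with index in \<open>J\<close> is a multiple of that variable.
\<close>

lemma Idl_mvar_eq:
  fixes n :: nat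
  assumes J: "J \<subseteq> {1..n}"
  defines "R \<equiv> mpoly_ring n :: 'k::field mpoly ring"
  shows "Idl\<^bsub>R\<^esub> (mvar ` J) =
    {p \<in> carrier R. \<forall>t \<in> Poly_Mapping.keys p. Poly_Mapping.keys t \<inter> J \<noteq> {}}" (is "_ = ?M")
proof
  interpret cring R unfolding R_def by (rule mpoly_ring_cring)
  note C = mpoly_ring_simps(1)[of _ n, where 'k = 'k, folded R_def]
  note ops = mpoly_ring_simps(2-5)[of n, where 'k = 'k, folded R_def]
  have vars: "mvar ` J \<subseteq> carrier R"
    using J mvar_closed unfolding R_def by blast
  have "ideal ?M R"
  proof (rule idealI)
    show "ring R" by (rule ring_axioms)
  next
    show "subgroup ?M (add_monoid R)"
    proof (rule add.subgroupI)
      show "?M \<subseteq> carrier R" by blast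
      have "0 \<in> ?M" by (simp add: C)
      then show "?M \<noteq> {}" by blast
    next
      fix p assume p: "p \<in> ?M"
      have "- p \<in> carrier R" using p by (simp add: C in_keys_iff)
      moreover have "p \<oplus>\<^bsub>R\<^esub> - p = \<zero>\<^bsub>R\<^esub>" by (simp add: ops)
      ultimately have "\<ominus>\<^bsub>R\<^esub> p = - p"
        using p by (simp add: minus_equality a_comm)
      then show "\<ominus>\<^bsub>R\<^esub> p \<in> ?M"
        using p by (simp add: C in_keys_iff)
    next
      fix p q assume p: "p \<in> ?M" and q: "q \<in> ?M"
      then have "p \<oplus>\<^bsub>R\<^esub> q \<in> carrier R" by simp
      then show "p \<oplus>\<^bsub>R\<^esub> q \<in> ?M"
        using p q Poly_Mapping.keys_add[of p q] by (auto simp: ops)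
    qed
  next
    fix p q assume p: "p \<in> ?M" and q: "q \<in> carrier R"
    have "Poly_Mapping.keys t \<inter> J \<noteq> {}" if t: "t \<in> Poly_Mapping.keys (q * p)" for t
    proof -
      obtain a b where "t = a + b" "b \<in> Poly_Mapping.keys p"
        using t keys_mult[of q p] by auto
      moreover have "Poly_Mapping.keys (a + b) = Poly_Mapping.keys a \<union> Poly_Mapping.keys b"
        by (auto simp: in_keys_iff lookup_add)
      ultimately show ?thesis using p by auto
    qed
    moreover have "q \<otimes>\<^bsub>R\<^esub> p \<in> carrier R" using p q by simp
    ultimately show "q \<otimes>\<^bsub>R\<^esub> p \<in> ?M" by (simp add: ops)
    then show "p \<otimes>\<^bsub>R\<^esub> q \<in> ?M" using p q by (simp add: m_comm)
  qed
  moreover have "mvar ` J \<subseteq> ?M"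
    using vars by (auto simp: mvar_def)
  ultimately show "Idl\<^bsub>R\<^esub> (mvar ` J) \<subseteq> ?M"
    by (rule genideal_minimal)
  interpret I: ideal "Idl\<^bsub>R\<^esub> (mvar ` J)" R
    by (rule genideal_ideal[OF vars])
  show "?M \<subseteq> Idl\<^bsub>R\<^esub> (mvar ` J)"
  proof
    fix p assume p: "p \<in> ?M"
    have sum_mem: "sum f A \<in> Idl\<^bsub>R\<^esub> (mvar ` J)"
      if "finite A" "\<And>t. t \<in> A \<Longrightarrow> f t \<in> Idl\<^bsub>R\<^esub> (mvar ` J)"
      for A and f :: "(nat \<Rightarrow>\<^sub>0 nat) \<Rightarrow> 'k mpoly"
      using that
    proof (induction A rule: finite_induct)
      case empty
      then show ?case using I.zero_closed by (simp add: ops)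
    next
      case (insert t A)
      then show ?case using I.a_closed[of "f t" "sum f A"] by (simp add: ops)
    qed
    have "Poly_Mapping.single t (Poly_Mapping.lookup p t) \<in> Idl\<^bsub>R\<^esub> (mvar ` J)"
      if t: "t \<in> Poly_Mapping.keys p" for t
    proof -
      obtain j where j: "j \<in> Poly_Mapping.keys t" "j \<in> J"
        using p t by auto
      \<comment> \<open>the subtraction of exponents is truncated; it is exact because \<open>t\<close> involves \<open>x\<^sub>j\<close>\<close>
      have split: "t = Poly_Mapping.single j 1 + (t - Poly_Mapping.single j 1)"
        using j(1)
        by (intro poly_mapping_eqI) (auto simp: lookup_add lookup_minus lookup_single when_def in_keys_iff)
      let ?q = "Poly_Mapping.single (t - Poly_Mapping.single j 1) (Poly_Mapping.lookup p t)"
      have "Poly_Mapping.keys (t - Poly_Mapping.single j 1) \<subseteq> Poly_Mapping.keys t"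
        by (auto simp: in_keys_iff lookup_minus)
      then have "?q \<in> carrier R"
        using p t by (simp add: C) blast
      moreover have "mvar j \<in> Idl\<^bsub>R\<^esub> (mvar ` J)"
        using genideal_self[OF vars] j(2) by blast
      moreover have "Poly_Mapping.single t (Poly_Mapping.lookup p t) = mvar j * ?q"
        unfolding mvar_def mult_single using split by simp
      ultimately show ?thesis
        using I.I_r_closed by (metis ops(1))
    qed
    then have "(\<Sum>t \<in> Poly_Mapping.keys p. Poly_Mapping.single t (Poly_Mapping.lookup p t))
        \<in> Idl\<^bsub>R\<^esub> (mvar ` J)"
      by (intro sum_mem finite_keys)
    also have "(\<Sum>t \<in> Poly_Mapping.keys p. Poly_Mapping.single t (Poly_Mapping.lookup p t)) = p"
      by (rule poly_mapping_eqI) (simp add: lookup_sum lookup_single when_def in_keys_iff)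
    finally show "p \<in> Idl\<^bsub>R\<^esub> (mvar ` J)" .
  qed
qed

lemma mvar_mem_Idl_iff:
  assumes "J \<subseteq> {1..n}"
  shows "(mvar j :: 'k::field mpoly) \<in> Idl\<^bsub>mpoly_ring n\<^esub> (mvar ` J) \<longleftrightarrow> j \<in> J"
  unfolding Idl_mvar_eq[OF assms] using assms by (auto simp: mvar_def mpoly_ring_simps)

text \<open>
  Discarding the terms in \<open>P\<^sub>J\<close> does not change a polynomial modulo \<open>P\<^sub>J\<close>, and what is left of it
  uses no variable with index in \<open>J\<close>.  If a product of two polynomials is in \<open>P\<^sub>J\<close>, then so is the
  product of what is left of them; but that product involves none of these variables, so it is zero,
  and polynomials have no zero divisors.
\<close>

lemma primeideal_Idl_mvar:
  fixes n :: nat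
  assumes J: "J \<subseteq> {1..n}"
  shows "primeideal (Idl\<^bsub>mpoly_ring n\<^esub> (mvar ` J)) (mpoly_ring n :: 'k::field mpoly ring)"
proof -
  define R where "R = (mpoly_ring n :: 'k mpoly ring)"
  interpret cring R unfolding R_def by (rule mpoly_ring_cring)
  note C = mpoly_ring_simps(1)[of _ n, where 'k = 'k, folded R_def]
  note ops = mpoly_ring_simps(2-5)[of n, where 'k = 'k, folded R_def]
  define I where "I = Idl\<^bsub>R\<^esub> (mvar ` J)"
  have I_eq: "I = {p \<in> carrier R. \<forall>t \<in> Poly_Mapping.keys p. Poly_Mapping.keys t \<inter> J \<noteq> {}}"
    unfolding I_def R_def by (rule Idl_mvar_eq[OF J])
  have "mvar ` J \<subseteq> carrier R"
    using J mvar_closed unfolding R_def by blast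
  then interpret I: ideal I R
    unfolding I_def by (rule genideal_ideal)
  define rest :: "'k mpoly \<Rightarrow> 'k mpoly" where
    "rest p = (\<Sum>t \<in> {t \<in> Poly_Mapping.keys p. Poly_Mapping.keys t \<inter> J = {}}.
       Poly_Mapping.single t (Poly_Mapping.lookup p t))" for p
  have lookup_rest: "Poly_Mapping.lookup (rest p) t =
      (if Poly_Mapping.keys t \<inter> J = {} then Poly_Mapping.lookup p t else 0)" for p t
    by (auto simp: rest_def lookup_sum lookup_single when_def in_keys_iff)
  have rest_carr: "rest p \<in> carrier R" if "p \<in> carrier R" for p
  proof -
    have "Poly_Mapping.keys (rest p) \<subseteq> Poly_Mapping.keys p"
      by (auto simp: in_keys_iff lookup_rest split: if_splits)
    then show ?thesis using that unfolding C by blast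
  qed
  have minus_carr: "p - q \<in> carrier R" if "p \<in> carrier R" "q \<in> carrier R" for p q
    using that keys_diff[of p q] unfolding C by blast
  have diff_mem: "p - rest p \<in> I" if "p \<in> carrier R" for p
  proof -
    have "Poly_Mapping.keys t \<inter> J \<noteq> {}" if "t \<in> Poly_Mapping.keys (p - rest p)" for t
      using that by (auto simp: in_keys_iff[of t] lookup_minus lookup_rest)
    then show ?thesis
      using minus_carr[OF that rest_carr[OF that]] unfolding I_eq by blast
  qed
  have mem_iff: "p \<in> I \<longleftrightarrow> rest p = 0" if "p \<in> carrier R" for p
  proof
    assume "p \<in> I"
    then show "rest p = 0"
      unfolding I_eq by (intro poly_mapping_eqI) (auto simp: in_keys_iff lookup_rest)
  next
    assume "rest p = 0"
    with diff_mem[OF that] show "p \<in> I" by simp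
  qed
  have "primeideal I R"
  proof (rule primeidealI)
    show "ideal I R" "cring R" by unfold_locales
    have "1 \<notin> I" unfolding I_eq by simp
    then show "carrier R \<noteq> I" using one_closed by (auto simp: ops)
  next
    fix p q assume p: "p \<in> carrier R" and q: "q \<in> carrier R" and "p \<otimes>\<^bsub>R\<^esub> q \<in> I"
    \<comment> \<open>modulo \<open>P\<^sub>J\<close>, the product of the rests agrees with \<open>p * q\<close>, so it is in \<open>P\<^sub>J\<close> too\<close>
    have rpq: "p * q - (rest p * (q - rest q) + q * (p - rest p)) = rest p * rest q"
      by (simp add: algebra_simps)
    have "rest p * (q - rest q) \<in> I" "q * (p - rest p) \<in> I"
      using I.I_l_closed[OF diff_mem[OF q] rest_carr[OF p]] I.I_l_closed[OF diff_mem[OF p] q]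
      by (simp_all add: ops)
    then have s: "rest p * (q - rest q) + q * (p - rest p) \<in> I"
      using I.a_closed by (simp add: ops)
    have "Poly_Mapping.keys t \<inter> J \<noteq> {}"
      if t: "t \<in> Poly_Mapping.keys (rest p * rest q)" for t
    proof -
      have "t \<in> Poly_Mapping.keys (p * q) \<or>
          t \<in> Poly_Mapping.keys (rest p * (q - rest q) + q * (p - rest p))"
        using t keys_diff[of "p * q"] unfolding rpq[symmetric] by blast
      then show ?thesis
        using s \<open>p \<otimes>\<^bsub>R\<^esub> q \<in> I\<close> unfolding I_eq ops by blast
    qed
    moreover have "Poly_Mapping.keys t \<inter> J = {}"
      if t: "t \<in> Poly_Mapping.keys (rest p * rest q)" for t
    proof -
      obtain a b where "t = a + b" and "a \<in> Poly_Mapping.keys (rest p)"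
        and "b \<in> Poly_Mapping.keys (rest q)"
        using t keys_mult[of "rest p" "rest q"] by auto
      then show ?thesis
        using Poly_Mapping.keys_add[of a b]
        by (auto simp: in_keys_iff[of _ "rest _"] lookup_rest split: if_splits)
    qed
    ultimately have "Poly_Mapping.keys (rest p * rest q) = {}" by blast
    then have "rest p * rest q = 0" by simp
    then show "p \<in> I \<or> q \<in> I"
      using mem_iff p q by simp
  qed
  then show ?thesis unfolding I_def R_def .
qed

section \<open>Prime ideals that contain the neighbourhood ideal\<close>

lemma prod_mvar_closed:
  assumes "W \<subseteq> {1..n}"
  shows "(\<Prod>j \<in> W. mvar j) \<in> carrier (mpoly_ring n :: 'k::field mpoly ring)"
proof -
  interpret cring "mpoly_ring n :: 'k mpoly ring" by (rule mpoly_ring_cring)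
  show ?thesis
    using finite_subset[OF assms finite_atLeastAtMost] assms
  proof (induction W rule: finite_induct)
    case empty
    show ?case using one_closed by (simp add: mpoly_ring_simps(4))
  next
    case (insert a W)
    then show ?case
      using m_closed[OF mvar_closed[of a n], of "\<Prod>j \<in> W. mvar j"]
      by (simp add: mpoly_ring_simps(2))
  qed
qed

lemma prod_mvar_mem_prime_iff:
  assumes Q: "primeideal Q (mpoly_ring n :: 'k::field mpoly ring)" and W: "W \<subseteq> {1..n}"
  shows "(\<Prod>j \<in> W. mvar j) \<in> Q \<longleftrightarrow> (\<exists>j \<in> W. mvar j \<in> Q)"
proof -
  interpret Q: primeideal Q "mpoly_ring n" by (rule Q)
  show ?thesis
    using finite_subset[OF W finite_atLeastAtMost] W
  proof (induction W rule: finite_induct)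
    case empty
    have "1 \<notin> Q"
      using Q.one_imp_carrier Q.I_notcarr by (auto simp: mpoly_ring_simps)
    then show ?case by simp
  next
    case (insert a W)
    let ?x = "mvar a :: 'k mpoly" and ?y = "\<Prod>j \<in> W. mvar j :: 'k mpoly"
    have x: "?x \<in> carrier (mpoly_ring n)" and y: "?y \<in> carrier (mpoly_ring n)"
      using insert.prems mvar_closed[of a n] prod_mvar_closed[of W n] by auto
    have "?x * ?y \<in> Q \<longleftrightarrow> ?x \<in> Q \<or> ?y \<in> Q"
      using Q.I_prime[OF x y] Q.I_l_closed[OF _ x] Q.I_r_closed[OF _ y]
      by (auto simp: mpoly_ring_simps(2))
    then show ?case
      using insert by simp
  qed
qed

text \<open>
  A \<open>k\<close>-subset of \<open>N\<close> that avoids \<open>D\<close> exists iff \<open>N - D\<close> has at least \<open>k\<close> elements.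
\<close>

lemma meets_all_subsets_iff_card_Int:
  assumes N: "finite N" and "card N + 1 = m + k"
  shows "(\<forall>W. W \<subseteq> N \<and> card W = k \<longrightarrow> W \<inter> D \<noteq> {}) \<longleftrightarrow> m \<le> card (N \<inter> D)"
proof -
  have "(\<exists>W. W \<subseteq> N \<and> card W = k \<and> W \<inter> D = {}) \<longleftrightarrow> (\<exists>W \<subseteq> N - D. card W = k)"
    by blast
  also have "\<dots> \<longleftrightarrow> k \<le> card (N - D)"
    using N by (meson card_mono finite_Diff obtain_subset_with_card_n)
  finally have "(\<forall>W. W \<subseteq> N \<and> card W = k \<longrightarrow> W \<inter> D \<noteq> {}) \<longleftrightarrow> card (N - D) < k"
    unfolding not_le[symmetric] by blast
  moreover have "card N = card (N \<inter> D) + card (N - D)"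
    using N by (metis card_Int_Diff)
  then have "card (N - D) < k \<longleftrightarrow> m \<le> card (N \<inter> D)"
    using assms(2) by arith
  ultimately show ?thesis by simp
qed

lemma (in pair_graph) card_closed_nbhd:
  shows "finite (closed_nbhd G i)" and "card (closed_nbhd G i) = out_degree (with_proj G) i + 1"
proof -
  have eq: "{j. (i, j) \<in> parcs G} = snd ` {e \<in> parcs G. fst e = i}"
    by force
  have fin: "finite {j. (i, j) \<in> parcs G}"
    unfolding eq using pair_finite_arcs by simp
  have "inj_on snd {e \<in> parcs G. fst e = i}"
    by (auto simp: inj_on_def)
  then have "card {j. (i, j) \<in> parcs G} = out_degree (with_proj G) i"
    unfolding eq by (simp add: card_image out_degree_def out_arcs_def)
  moreover have "(i, i) \<notin> parcs G"
    using pair_no_loops by fastforce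
  ultimately show "card (closed_nbhd G i) = out_degree (with_proj G) i + 1"
    using fin by (simp add: closed_nbhd_def)
  show "finite (closed_nbhd G i)"
    using fin by (simp add: closed_nbhd_def)
qed

text \<open>
  The bridge between algebra and domination.  It is stated for an arbitrary prime ideal, not only for
  those generated by variables, because the competitors of \<open>P\<^sub>J\<close> in the definition of a minimal prime
  range over all prime ideals.
\<close>

lemma nbhd_ideal_subset_prime_iff:
  fixes Q :: "'k::field mpoly set"
  assumes G: "pair_graph G" and V: "pverts G = {1..n}"
    and m: "\<And>i. i \<in> {1..n} \<Longrightarrow> out_degree (with_proj G) i + 2 = m i + k i"
    and Q: "primeideal Q (mpoly_ring n)"
  shows "nbhd_ideal n k G \<subseteq> Q \<longleftrightarrow> multiple_dominating G m {j \<in> {1..n}. mvar j \<in> Q}"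
proof -
  interpret G: pair_graph G by (rule G)
  interpret R: cring "mpoly_ring n :: 'k mpoly ring" by (rule mpoly_ring_cring)
  interpret Q: primeideal Q "mpoly_ring n" by (rule Q)
  let ?V = "{j \<in> {1..n}. mvar j \<in> Q}"
  let ?gens = "\<lambda>i. {\<Prod>j\<in>W. mvar j :: 'k mpoly | W. W \<subseteq> closed_nbhd G i \<and> card W = k i}"
  have nbhd: "closed_nbhd G i \<subseteq> {1..n}" if "i \<in> {1..n}" for i
    using that G.arc_snd_in_verts V by (fastforce simp: closed_nbhd_def)
  have gens: "?gens i \<subseteq> carrier (mpoly_ring n)" if i: "i \<in> {1..n}" for i
    using nbhd[OF i] by (auto intro!: prod_mvar_closed)
  have "nbhd_ideal n k G \<subseteq> Q \<longleftrightarrow> (\<forall>i \<in> {1..n}. Idl\<^bsub>mpoly_ring n\<^esub> (?gens i) \<subseteq> Q)"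
    unfolding nbhd_ideal_def
    by (rule R.finsum_ideals_subset_iff[OF finite_atLeastAtMost R.genideal_ideal[OF gens] Q.is_ideal])
  also have "\<dots> \<longleftrightarrow> (\<forall>i \<in> {1..n}. ?gens i \<subseteq> Q)"
    using R.Idl_subset_ideal[OF Q.is_ideal gens] by blast
  also have "\<dots> \<longleftrightarrow> (\<forall>i \<in> {1..n}. m i \<le> card (closed_nbhd G i \<inter> ?V))"
  proof (rule ball_cong[OF refl])
    fix i assume i: "i \<in> {1..n}"
    have "(\<Prod>j\<in>W. mvar j) \<in> Q \<longleftrightarrow> W \<inter> ?V \<noteq> {}" if "W \<subseteq> closed_nbhd G i" for W
      using prod_mvar_mem_prime_iff[OF Q, of W] nbhd[OF i] that by blast
    then have "?gens i \<subseteq> Q \<longleftrightarrow>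
        (\<forall>W. W \<subseteq> closed_nbhd G i \<and> card W = k i \<longrightarrow> W \<inter> ?V \<noteq> {})"
      by blast
    also have "\<dots> \<longleftrightarrow> m i \<le> card (closed_nbhd G i \<inter> ?V)"
      using m[OF i] G.card_closed_nbhd by (intro meets_all_subsets_iff_card_Int) auto
    finally show "?gens i \<subseteq> Q \<longleftrightarrow> m i \<le> card (closed_nbhd G i \<inter> ?V)" .
  qed
  finally show ?thesis
    by (auto simp: multiple_dominating_def V)
qed

theorem lemma2p2:
  fixes n :: nat and G :: "nat pair_pre_digraph" and k m :: "nat \<Rightarrow> nat"
    and J :: "nat set" and P :: "'k::field mpoly set"
  assumes "pair_graph G" and "pverts G = {1..n}"
    and "\<forall>i \<in> {1..n}. out_degree (with_proj G) i \<noteq> 0"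
    and "\<forall>i \<in> {1..n}. 1 \<le> k i \<and> k i \<le> out_degree (with_proj G) i + 1"
    and "\<forall>i \<in> {1..n}. int (m i) = int (out_degree (with_proj G) i) - int (k i) + 2"
    and "J \<subseteq> {1..n}" and "P = Idl\<^bsub>mpoly_ring n\<^esub> (mvar ` J)"
  shows "minimal_prime_over (mpoly_ring n) (nbhd_ideal n k G) P
    \<longleftrightarrow> minimal_multiple_dominating G m J"
proof -
  interpret R: cring "mpoly_ring n :: 'k mpoly ring" by (rule mpoly_ring_cring)
  let ?NI = "nbhd_ideal n k G :: 'k mpoly set"
  let ?P = "\<lambda>D. Idl\<^bsub>mpoly_ring n\<^esub> (mvar ` D) :: 'k mpoly set"
  let ?V = "\<lambda>Q :: 'k mpoly set. {j \<in> {1..n}. mvar j \<in> Q}"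
  have "out_degree (with_proj G) i + 2 = m i + k i" if "i \<in> {1..n}" for i
    using assms(5) that by force
  then have contains_iff: "?NI \<subseteq> Q \<longleftrightarrow> multiple_dominating G m (?V Q)"
    if "primeideal Q (mpoly_ring n)" for Q
    by (rule nbhd_ideal_subset_prime_iff[OF assms(1,2) _ that])
  have V_P: "?V (?P D) = D" if "D \<subseteq> {1..n}" for D
    using that mvar_mem_Idl_iff[OF that, where 'k = 'k] by blast
  have P_subset: "?P D \<subseteq> Q" if "ideal Q (mpoly_ring n)" "D \<subseteq> ?V Q" for D Q
    using that by (intro R.genideal_minimal) auto
  have P_contains_iff: "?NI \<subseteq> ?P D \<longleftrightarrow> multiple_dominating G m D" if "D \<subseteq> {1..n}" for D
    using contains_iff[OF primeideal_Idl_mvar[OF that]] V_P[OF that] by simp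
  have "(\<exists>Q. primeideal Q (mpoly_ring n) \<and> ?NI \<subseteq> Q \<and> Q \<subset> ?P J) \<longleftrightarrow>
      (\<exists>D. multiple_dominating G m D \<and> D \<subset> J)"
  proof
    assume "\<exists>Q. primeideal Q (mpoly_ring n) \<and> ?NI \<subseteq> Q \<and> Q \<subset> ?P J"
    then obtain Q where Q: "primeideal Q (mpoly_ring n)" "?NI \<subseteq> Q" "Q \<subset> ?P J"
      by blast
    have "?V Q \<subseteq> J"
      using Q(3) V_P[OF assms(6)] by blast
    moreover have "?V Q \<noteq> J"
      using P_subset[OF primeideal.axioms(1)[OF Q(1)], of J] Q(3) by blast
    ultimately show "\<exists>D. multiple_dominating G m D \<and> D \<subset> J"
      using contains_iff[OF Q(1)] Q(2) by blast
  next
    assume "\<exists>D. multiple_dominating G m D \<and> D \<subset> J"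
    then obtain D where D: "multiple_dominating G m D" "D \<subset> J"
      by blast
    have DV: "D \<subseteq> {1..n}" using D(2) assms(6) by blast
    have "?P D \<subseteq> ?P J"
    proof (rule P_subset)
      show "ideal (?P J) (mpoly_ring n)"
        by (rule primeideal.axioms(1)[OF primeideal_Idl_mvar[OF assms(6)]])
      show "D \<subseteq> ?V (?P J)"
        unfolding V_P[OF assms(6)] using D(2) by blast
    qed
    moreover have "?P D \<noteq> ?P J"
      using V_P[OF DV] V_P[OF assms(6)] D(2) by auto
    ultimately show "\<exists>Q. primeideal Q (mpoly_ring n) \<and> ?NI \<subseteq> Q \<and> Q \<subset> ?P J"
      using primeideal_Idl_mvar[OF DV] P_contains_iff[OF DV] D(1) by blast
  qed
  then show ?thesis
    using primeideal_Idl_mvar[OF assms(6)] P_contains_iff[OF assms(6)]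
    unfolding minimal_prime_over_def minimal_multiple_dominating_def assms(7) by blast
qed

end
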